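(* Let $n\ge 1$ be an integer, $p\in[0,1)$, $\mu>0$, $w\in\mathbb{R}^d$, and let $L(w)=(L^1(w),\dots,L^n(w))\in\mathbb{R}^n$ be a given vector of loss values. Consider the problem $$\max_{q\in\Delta_n,\; q_i\le \frac{1}{n(1-p)}\ \forall i}\ \sum_{i=1}^n q_i\,L^i(w)-\mu\, d(q),\qquad d(q)=\frac12\sum_{i=1}^n\Big(q_i-\frac1n\Big)^2,$$ where $\Delta_n=\{q\in\mathbb{R}^n: q_i\ge 0\ \forall i,\ \sum_{i=1}^n q_i=1\}$. Then the Fast Subroutine (described in the context), run on the input $L(w),\mu,p$, outputs the (unique) optimal solution $q_\mu\in\mathbb{R}^n$ of this problem, at a cost of $O(n)$ operations.
   Context: Fast Subroutine. Input: the vector $L(w)=(L^1(w),\dots,L^n(w))\in\mathbb{R}^n$, $\mu>0$, and $p\in[0,1)$. Initialization: set $u_i = L^i(w)+\frac{\mu}{n}$ for $i=1,\dots,n$, set $\ell=\frac{1}{n(1-p)}$, and set $q_\mu=0\in\mathbb{R}^n$. Let $\theta':\mathbb{R}\to\mathbb{R}$ denote the function $$\theta'(\lambda)=1-\sum_{i=1}^n\Big(\frac{u_i-\lambda}{\mu}\,\mathbf{1}_{\{u_i\ge\lambda\ge u_i-\mu\ell\}}+\ell\,\mathbf{1}_{\{u_i-\mu\ell>\lambda\}}\Big),$$ which is the derivative of the dual function $\theta(\lambda)=\max_{q\in\mathbb{R}^n,\,0\le q_i\le\ell}\big[\sum_{i=1}^n q_iL^i(w)-\frac{\mu}{2}\sum_{i=1}^n(q_i-\frac1n)^2+\lambda(1-\sum_{i=1}^n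 q_i)\big]$. Step 1: with $\mathcal{P}=\{u_i,\ u_i-\mu\ell : i\in\{1,\dots,n\}\}$, find $$a=\max\{s\in\mathcal{P}:\theta'(s)\le 0\},\qquad b=\min\{s\in\mathcal{P}:\theta'(s)>0\}.$$ Step 2: set $\lambda=a-\dfrac{\theta'(a)(b-a)}{\theta'(b)-\theta'(a)}$. Step 3: for each $k\in\{1,\dots,n\}$, set $$[q_\mu]_k=\begin{cases}\ell & \text{if }\lambda<u_k-\mu\ell,\\[2pt] \dfrac{u_k-\lambda}{\mu} & \text{if }u_k-\mu\ell\le\lambda<u_k,\\[2pt] 0 & \text{otherwise.}\end{cases}$$ Output: $q_\mu\in\mathbb{R}^n$. The cost counts the operations performed by the subroutine once the vector $L(w)$ is given, as a function of $n$. *)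

theory Defs
  imports "HOL-Analysis.Analysis" "HOL-Library.Landau_Symbols" "HOL-Library.Monad_Syntax"
begin

section \<open>The smoothed problem\<close>

text \<open>
  Vectors of \<open>\<real>\<^sup>n\<close> are real lists of length \<open>n\<close>, with indices running from \<open>0\<close> to \<open>n - 1\<close>:
  the dimension is the input size, so it has to be a term and not a type.
\<close>

definition prob_simplex :: "nat \<Rightarrow> real list set" where
  "prob_simplex n = {q. length q = n \<and> (\<forall>i<n. 0 \<le> q ! i) \<and> (\<Sum>i<n. q ! i) = 1}"

definition cap :: "nat \<Rightarrow> real \<Rightarrow> real" where
  "cap n p = 1 / (real n * (1 - p))"

definition feasible :: "nat \<Rightarrow> real \<Rightarrow> real list set" where
  "feasible n p = {q \<in> prob_simplex n. \<forall>i<n. q ! i \<le> cap n p}"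

definition dist_uniform :: "real list \<Rightarrow> real" where
  "dist_uniform q = 1/2 * (\<Sum>i<length q. (q ! i - 1 / real (length q))\<^sup>2)"

definition objective :: "real list \<Rightarrow> real \<Rightarrow> real list \<Rightarrow> real" where
  "objective ls \<mu> q = (\<Sum>i<length ls. q ! i * ls ! i) - \<mu> * dist_uniform q"


section \<open>The Fast Subroutine\<close>

definition dual_deriv :: "real list \<Rightarrow> real \<Rightarrow> real \<Rightarrow> real \<Rightarrow> real" where
  "dual_deriv u \<mu> \<kappa> x =
     1 - (\<Sum>i<length u. (u ! i - x) / \<mu> * of_bool (u ! i \<ge> x \<and> x \<ge> u ! i - \<mu> * \<kappa>)
                        + \<kappa> * of_bool (u ! i - \<mu> * \<kappa> > x))"

definition fast_subroutine :: "real list \<Rightarrow> real \<Rightarrow> real \<Rightarrow> real list" where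
  "fast_subroutine ls \<mu> p =
    (let n = length ls;
         u = map (\<lambda>x. x + \<mu> / real n) ls;
         \<kappa> = cap n p;
         P = set u \<union> (\<lambda>x. x - \<mu> * \<kappa>) ` set u;
         a = Max {s \<in> P. dual_deriv u \<mu> \<kappa> s \<le> 0};
         b = Min {s \<in> P. dual_deriv u \<mu> \<kappa> s > 0};
         lam = a - dual_deriv u \<mu> \<kappa> a * (b - a) / (dual_deriv u \<mu> \<kappa> b - dual_deriv u \<mu> \<kappa> a)
     in map (\<lambda>x. if lam < x - \<mu> * \<kappa> then \<kappa>
                 else if x - \<mu> * \<kappa> \<le> lam \<and> lam < x then (x - lam) / \<mu>
                 else 0) u)"


section \<open>Computations with an operation count\<close>

text \<open>
  Unit-cost model. One operation is charged for every arithmetic operation and comparison (on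
  reals or on naturals), every construction of a list cell or pair, and every call of a recursive
  function; a call includes the inspection of its arguments by pattern matching, and a comparison
  includes the branch taken on it. Programs are built from these primitives with \<open>bind_tm\<close>,
  which adds the costs.
\<close>

datatype 'a tm = TM (result: 'a) (cost: nat)

definition return :: "'a \<Rightarrow> 'a tm" where
  "return x = TM x 0"

definition op1 :: "'a \<Rightarrow> 'a tm" where
  "op1 x = TM x 1"

definition call :: "unit tm" where
  "call = TM () 1"

definition bind_tm :: "'a tm \<Rightarrow> ('a \<Rightarrow> 'b tm) \<Rightarrow> 'b tm" where
  "bind_tm m f = TM (result (f (result m))) (cost m + cost (f (result m)))"

adhoc_overloading Monad_Syntax.bind \<rightleftharpoons> bind_tm

lemma bind_tm_cong [fundef_cong]:
  assumes "m = m'" "\<And>x. x = result m' \<Longrightarrow> f x = f' x"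
  shows "bind_tm m f = bind_tm m' f'"
  using assms by (simp add: bind_tm_def)

lemma result_simps [simp]:
  "result (return x) = x"
  "result (op1 x) = x"
  "result (bind_tm m f) = result (f (result m))"
  by (simp_all add: return_def op1_def bind_tm_def)

lemma cost_simps [simp]:
  "cost (return x) = 0"
  "cost (op1 x) = 1"
  "cost call = 1"
  "cost (bind_tm m f) = cost m + cost (f (result m))"
  by (simp_all add: return_def op1_def call_def bind_tm_def)


subsection \<open>List operations\<close>

fun length_tm :: "'a list \<Rightarrow> nat tm" where
  "length_tm [] = do { call; return 0 }"
| "length_tm (x # xs) = do { call; n \<leftarrow> length_tm xs; op1 (n + 1) }"

fun nth_tm :: "real list \<Rightarrow> nat \<Rightarrow> real tm" where
  "nth_tm [] k = do { call; return 0 }"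
| "nth_tm (x # xs) 0 = do { call; return x }"
| "nth_tm (x # xs) (Suc k) = do { call; nth_tm xs k }"

fun append_tm :: "'a list \<Rightarrow> 'a list \<Rightarrow> 'a list tm" where
  "append_tm [] ys = do { call; return ys }"
| "append_tm (x # xs) ys = do { call; zs \<leftarrow> append_tm xs ys; op1 (x # zs) }"

fun map_list_tm :: "('a \<Rightarrow> 'b tm) \<Rightarrow> 'a list \<Rightarrow> 'b list tm" where
  "map_list_tm f [] = do { call; return [] }"
| "map_list_tm f (x # xs) = do { call; y \<leftarrow> f x; ys \<leftarrow> map_list_tm f xs; op1 (y # ys) }"

fun filter_tm :: "('a \<Rightarrow> bool tm) \<Rightarrow> 'a list \<Rightarrow> 'a list tm" where
  "filter_tm f [] = do { call; return [] }"
| "filter_tm f (x # xs) =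
     do { call; c \<leftarrow> f x; ys \<leftarrow> filter_tm f xs; if c then op1 (x # ys) else return ys }"

fun sum_tm :: "('a \<Rightarrow> real tm) \<Rightarrow> 'a list \<Rightarrow> real tm" where
  "sum_tm f [] = do { call; return 0 }"
| "sum_tm f (x # xs) = do { call; y \<leftarrow> f x; s \<leftarrow> sum_tm f xs; op1 (y + s) }"

lemma result_length_tm [simp]: "result (length_tm xs) = length xs"
  by (induction xs) auto

lemma result_nth_tm [simp]: "k < length xs \<Longrightarrow> result (nth_tm xs k) = xs ! k"
  by (induction xs k rule: nth_tm.induct) auto

lemma result_map_list_tm [simp]: "result (map_list_tm f xs) = map (\<lambda>x. result (f x)) xs"
  by (induction xs) auto

lemma result_filter_tm [simp]: "result (filter_tm f xs) = filter (\<lambda>x. result (f x)) xs"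
  by (induction xs) auto


subsection \<open>Selection in linear time\<close>

fun insort_tm :: "real \<Rightarrow> real list \<Rightarrow> real list tm" where
  "insort_tm x [] = do { call; op1 [x] }"
| "insort_tm x (y # ys) =
     do { call; c \<leftarrow> op1 (x \<le> y);
          if c then do { zs \<leftarrow> op1 (y # ys); op1 (x # zs) }
          else do { zs \<leftarrow> insort_tm x ys; op1 (y # zs) } }"

fun isort_tm :: "real list \<Rightarrow> real list tm" where
  "isort_tm [] = do { call; return [] }"
| "isort_tm (x # xs) = do { call; ys \<leftarrow> isort_tm xs; insort_tm x ys }"

text \<open>Medians of consecutive groups of five; an incomplete last group is dropped.\<close>

fun medians5_tm :: "real list \<Rightarrow> real list tm" where
  "medians5_tm (x1 # x2 # x3 # x4 # x5 # xs) =
     do { call; g \<leftarrow> TM [x1, x2, x3, x4, x5] 5; ys \<leftarrow> isort_tm g; m \<leftarrow> nth_tm ys 2;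
          ms \<leftarrow> medians5_tm xs; op1 (m # ms) }"
| "medians5_tm xs = do { call; return [] }"

lemma mset_insort_tm: "mset (result (insort_tm x xs)) = add_mset x (mset xs)"
  by (induction xs) auto

lemma mset_isort_tm: "mset (result (isort_tm xs)) = mset xs"
  by (induction xs) (auto simp: mset_insort_tm)

lemma set_isort_tm [simp]: "set (result (isort_tm xs)) = set xs"
  by (metis mset_isort_tm set_mset_mset)

lemma length_isort_tm [simp]: "length (result (isort_tm xs)) = length xs"
  by (metis mset_isort_tm size_mset)

lemma length_medians5_tm [simp]: "length (result (medians5_tm xs)) = length xs div 5"
  by (induction xs rule: medians5_tm.induct) auto

lemma set_medians5_tm: "set (result (medians5_tm xs)) \<subseteq> set xs"
proof (induction xs rule: medians5_tm.induct)
  case (1 x1 x2 x3 x4 x5 xs)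
  define ys where "ys = result (isort_tm [x1, x2, x3, x4, x5])"
  have "length ys = 5" "set ys = {x1, x2, x3, x4, x5}"
    unfolding ys_def by (simp_all del: isort_tm.simps)
  then have "result (nth_tm ys 2) \<in> {x1, x2, x3, x4, x5}"
    using nth_mem[of 2 ys] by simp
  with 1 show ?case
    by (auto simp: ys_def simp del: isort_tm.simps)
qed auto

text \<open>\<open>select_tm k xs\<close> computes the element of rank \<open>k\<close> (counted from \<open>0\<close>) of \<open>xs\<close>.\<close>

function select_tm :: "nat \<Rightarrow> real list \<Rightarrow> real tm" where
  "select_tm k xs =
     do { call; n \<leftarrow> length_tm xs; small \<leftarrow> op1 (n \<le> 20);
          if small then do { ys \<leftarrow> isort_tm xs; nth_tm ys k }
          else do {
            ms \<leftarrow> medians5_tm xs; nm \<leftarrow> length_tm ms; h \<leftarrow> op1 (nm div 2);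
            m \<leftarrow> select_tm h ms;
            lts \<leftarrow> filter_tm (\<lambda>x. op1 (x < m)) xs;
            eqs \<leftarrow> filter_tm (\<lambda>x. op1 (x = m)) xs;
            gts \<leftarrow> filter_tm (\<lambda>x. op1 (x > m)) xs;
            nl \<leftarrow> length_tm lts; ne \<leftarrow> length_tm eqs; nle \<leftarrow> op1 (nl + ne);
            left \<leftarrow> op1 (k < nl);
            if left then select_tm k lts
            else do {
              mid \<leftarrow> op1 (k < nle);
              if mid then return m
              else do { k' \<leftarrow> op1 (k - nle); select_tm k' gts } } } }"
  by pat_completeness auto

lemma filter_length_less: "m \<in> set xs \<Longrightarrow> \<not> Q m \<Longrightarrow> length (filter Q xs) < length xs"
  by (meson length_filter_less)

lemma length_filter_three:
  fixes m :: real
  shows "length (filter (\<lambda>x. x < m) xs) + length (filter (\<lambda>x. x = m) xs)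
           + length (filter (\<lambda>x. x > m) xs) = length xs"
  by (induction xs) auto

lemma select_tm_dom_in_set:
  assumes "select_tm_dom (k, xs)" "k < length xs"
  shows "result (select_tm k xs) \<in> set xs"
  using assms
proof (induction k xs rule: select_tm.pinduct)
  case (1 k xs)
  show ?case
  proof (cases "length xs \<le> 20")
    case True
    have "result (isort_tm xs) ! k \<in> set (result (isort_tm xs))"
      using 1(5) by (intro nth_mem) simp
    then show ?thesis
      using True 1(5) by (simp add: select_tm.psimps[OF 1(1)])
  next
    case False
    define ms where "ms = result (medians5_tm xs)"
    define m where "m = result (select_tm (length ms div 2) ms)"
    have "length ms div 2 < length ms"
      using False by (simp add: ms_def)
    then have "m \<in> set ms"
      using 1(2)[OF refl refl refl _ refl refl refl] False unfolding m_def ms_def by simp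
    then have m: "m \<in> set xs"
      using set_medians5_tm by (auto simp: ms_def)
    define lts where "lts = filter (\<lambda>x. x < m) xs"
    define gts where "gts = filter (\<lambda>x. x > m) xs"
    define ne where "ne = length (filter (\<lambda>x. x = m) xs)"
    have len: "length lts + ne + length gts = length xs"
      unfolding lts_def gts_def ne_def by (rule length_filter_three)
    have 2: "result (select_tm k lts) \<in> set lts" if "k < length lts"
      using 1(3)[OF refl refl refl _ refl refl refl refl refl refl refl refl refl refl refl] False that unfolding lts_def m_def ms_def by simp
    have 3: "result (select_tm (k - (length lts + ne)) gts) \<in> set gts"
      if "\<not> k < length lts" "\<not> k < length lts + ne"
    proof -
      have "k - (length lts + ne) < length gts"
        using that 1(5) len by linarith
      with 1(4)[OF refl refl refl _ refl refl refl refl refl refl refl refl refl refl refl _ refl _ refl, unfolded result_simps result_length_tm result_filter_tm,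
          folded ms_def, folded m_def, folded lts_def gts_def ne_def] False that
      show ?thesis
        by blast
    qed
    have "result (select_tm k xs) =
      (if k < length lts then result (select_tm k lts)
       else if k < length lts + ne then m
       else result (select_tm (k - (length lts + ne)) gts))"
      unfolding lts_def gts_def ne_def m_def ms_def
      using False by (simp add: select_tm.psimps[OF 1(1)])
    moreover have "set lts \<subseteq> set xs" "set gts \<subseteq> set xs"
      by (auto simp: lts_def gts_def)
    ultimately show ?thesis
      using 2 3 m by (auto split: if_splits)
  qed
qed

lemma pivot_in_set:
  assumes "select_tm_dom (length (result (medians5_tm xs)) div 2, result (medians5_tm xs))"
    and "\<not> length xs \<le> 20"
  shows "result (select_tm (length (result (medians5_tm xs)) div 2) (result (medians5_tm xs))) \<in> set xs"
proof -
  have "length (result (medians5_tm xs)) div 2 < length (result (medians5_tm xs))"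
    using assms(2) by simp
  from select_tm_dom_in_set[OF assms(1) this] show ?thesis
    using set_medians5_tm by blast
qed

lemma select_tm_total: "select_tm_dom x"
proof (rule select_tm.termination[THEN spec, of "Wellfounded.measure (\<lambda>(k, xs). length xs)"],
    goal_cases)
  case 1
  show ?case by simp
next
  case 2
  then show ?case by simp
next
  case (3 k xs)
  from 3 have "result (select_tm (length (result (medians5_tm xs)) div 2) (result (medians5_tm xs))) \<in> set xs"
    by (intro pivot_in_set) (simp_all only: result_simps result_length_tm, simp_all)
  note shorter = filter_length_less[OF this]
  show ?case
    unfolding 3 result_simps result_length_tm result_filter_tm in_measure case_prod_conv
    by (rule shorter) simp
next
  case (4 k xs)
  from 4(1-7,20) have "result (select_tm (length (result (medians5_tm xs)) div 2) (result (medians5_tm xs))) \<in> set xs"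
    by (intro pivot_in_set) (simp_all only: result_simps result_length_tm, simp_all)
  note shorter = filter_length_less[OF this]
  show ?case
    unfolding 4 result_simps result_length_tm result_filter_tm in_measure case_prod_conv
    by (rule shorter) simp
qed

termination select_tm
  by (simp add: select_tm_total)

lemma select_tm_in_set: "k < length xs \<Longrightarrow> result (select_tm k xs) \<in> set xs"
  by (rule select_tm_dom_in_set[OF select_tm_total])

declare select_tm.simps [simp del]


subsection \<open>The Fast Subroutine with its operation count\<close>

definition dual_deriv_tm :: "real list \<Rightarrow> real \<Rightarrow> real \<Rightarrow> real \<Rightarrow> real tm" where
  "dual_deriv_tm u \<mu> \<kappa> x =
     do { s \<leftarrow> sum_tm (\<lambda>y. do {
            w \<leftarrow> op1 (\<mu> * \<kappa>); v \<leftarrow> op1 (y - w);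
            c \<leftarrow> op1 (v > x);
            if c then return \<kappa>
            else do {
              c' \<leftarrow> op1 (y \<ge> x);
              if c' then do { z \<leftarrow> op1 (y - x); op1 (z / \<mu>) } else return 0 } }) u;
          op1 (1 - s) }"

text \<open>
  Search for \<open>a\<close> and \<open>b\<close> by pruning at medians, where \<open>\<theta>' = dual_deriv u \<mu> \<kappa>\<close>. The
  breakpoints are given by the list of the pairs \<open>(u\<^sub>i, 1)\<close> and \<open>(u\<^sub>i - \<mu> * \<kappa>, -1)\<close>: with the sum over all of them,
  \<open>\<theta>'(x) = 1 - (\<Sum>(s, \<sigma>). \<sigma> * max 0 (s - x)) / \<mu>\<close>. In \<open>search_tm \<mu> cs A B lo hi\<close>,
  the list \<open>cs\<close> holds the breakpoints that are still undecided, \<open>A\<close> and \<open>B\<close> are the sums of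
  \<open>\<sigma> * s\<close> and of \<open>\<sigma>\<close> over the breakpoints already discarded on the right, and \<open>lo\<close>, \<open>hi\<close> are
  the last breakpoints found with \<open>\<theta>' \<le> 0\<close>, respectively \<open>\<theta>' > 0\<close>. Breakpoints discarded on the
  left do not contribute to \<open>\<theta>'\<close> at the undecided ones.
\<close>

function search_tm ::
    "real \<Rightarrow> (real \<times> real) list \<Rightarrow> real \<Rightarrow> real \<Rightarrow> real \<Rightarrow> real \<Rightarrow> (real \<times> real) tm" where
  "search_tm \<mu> cs A B lo hi =
     do { call; n \<leftarrow> length_tm cs; stop \<leftarrow> op1 (n = 0);
          if stop then op1 (lo, hi)
          else do {
            ss \<leftarrow> map_list_tm (\<lambda>(s, \<sigma>). return s) cs; h \<leftarrow> op1 (n div 2);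
            m \<leftarrow> select_tm h ss;
            gts \<leftarrow> filter_tm (\<lambda>(s, \<sigma>). op1 (s > m)) cs;
            gA \<leftarrow> sum_tm (\<lambda>(s, \<sigma>). op1 (\<sigma> * s)) gts; gB \<leftarrow> sum_tm (\<lambda>(s, \<sigma>). return \<sigma>) gts;
            A' \<leftarrow> op1 (A + gA); B' \<leftarrow> op1 (B + gB);
            t \<leftarrow> op1 (B' * m); t \<leftarrow> op1 (A' - t); t \<leftarrow> op1 (t / \<mu>); t \<leftarrow> op1 (1 - t);
            c \<leftarrow> op1 (t \<le> 0);
            if c then search_tm \<mu> gts A B m hi
            else do {
              eqs \<leftarrow> filter_tm (\<lambda>(s, \<sigma>). op1 (s = m)) cs;
              eA \<leftarrow> sum_tm (\<lambda>(s, \<sigma>). op1 (\<sigma> * s)) eqs; eB \<leftarrow> sum_tm (\<lambda>(s, \<sigma>). return \<sigma>) eqs;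
              A'' \<leftarrow> op1 (A' + eA); B'' \<leftarrow> op1 (B' + eB);
              lts \<leftarrow> filter_tm (\<lambda>(s, \<sigma>). op1 (s < m)) cs;
              search_tm \<mu> lts A'' B'' lo m } } }"
  by pat_completeness auto

lemma pivot_filter_less:
  fixes cs :: "(real \<times> real) list" and Q :: "real \<times> real \<Rightarrow> bool"
  assumes "cs \<noteq> []"
    and "\<And>\<sigma>. \<not> Q (result (select_tm (length cs div 2) (map fst cs)), \<sigma>)"
  shows "length (filter Q cs) < length cs"
proof -
  have "length cs div 2 < length (map fst cs)"
    using assms(1) by simp
  from select_tm_in_set[OF this]
  have "result (select_tm (length cs div 2) (map fst cs)) \<in> fst ` set cs"
    by simp
  then show ?thesis
    using assms(2) by (auto intro: filter_length_less)
qed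

lemma result_return_fst: "(\<lambda>x. result (case x of (s, \<sigma>) \<Rightarrow> return s)) = fst"
  by (auto simp: fun_eq_iff)

termination search_tm
proof (relation "Wellfounded.measure (\<lambda>(\<mu>, cs, A, B, lo, hi). length cs)", goal_cases)
  case 1
  show ?case by simp
next
  case (2 \<mu> cs)
  from 2(2-4) have "cs \<noteq> []"
    by auto
  note shorter = pivot_filter_less[OF this]
  show ?case
    unfolding 2 result_simps result_length_tm result_filter_tm result_map_list_tm result_return_fst
      in_measure case_prod_conv
    by (rule shorter) simp
next
  case (3 \<mu> cs)
  from 3(2-4) have "cs \<noteq> []"
    by auto
  note shorter = pivot_filter_less[OF this]
  show ?case
    unfolding 3 result_simps result_length_tm result_filter_tm result_map_list_tm result_return_fst
      in_measure case_prod_conv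
    by (rule shorter) simp
qed

declare search_tm.simps [simp del]

text \<open>
  The initial values \<open>0\<close> of \<open>lo\<close> and \<open>hi\<close> are placeholders: they are overwritten, since both signs
  of \<open>\<theta>'\<close> occur among the breakpoints.
\<close>

definition fast_subroutine_tm :: "real list \<Rightarrow> real \<Rightarrow> real \<Rightarrow> real list tm" where
  "fast_subroutine_tm ls \<mu> p =
     do { n \<leftarrow> sum_tm (\<lambda>_. return 1) ls;
          c \<leftarrow> op1 (\<mu> / n);
          u \<leftarrow> map_list_tm (\<lambda>x. op1 (x + c)) ls;
          r \<leftarrow> op1 (1 - p); r \<leftarrow> op1 (n * r); \<kappa> \<leftarrow> op1 (1 / r);
          w \<leftarrow> op1 (\<mu> * \<kappa>);
          ps \<leftarrow> map_list_tm (\<lambda>x. op1 (x, 1)) u;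
          ns \<leftarrow> map_list_tm (\<lambda>x. do { v \<leftarrow> op1 (x - w); op1 (v, - 1) }) u;
          cs \<leftarrow> append_tm ps ns;
          (a, b) \<leftarrow> search_tm \<mu> cs 0 0 0 0;
          ta \<leftarrow> dual_deriv_tm u \<mu> \<kappa> a;
          tb \<leftarrow> dual_deriv_tm u \<mu> \<kappa> b;
          d \<leftarrow> op1 (b - a); d \<leftarrow> op1 (ta * d); e \<leftarrow> op1 (tb - ta); d \<leftarrow> op1 (d / e);
          lam \<leftarrow> op1 (a - d);
          map_list_tm (\<lambda>x. do {
            v \<leftarrow> op1 (x - w);
            c1 \<leftarrow> op1 (lam < v);
            if c1 then return \<kappa>
            else do {
              c2 \<leftarrow> op1 (lam < x);
              if c2 then do { z \<leftarrow> op1 (x - lam); op1 (z / \<mu>) } else return 0 } }) u }"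

end

theory Submission
  imports Defs
begin

text \<open>
  Expanding the square in \<open>d\<close> turns the objective into
  \<open>\<Sum>\<^sub>i (q\<^sub>i u\<^sub>i - \<mu>/2 q\<^sub>i\<^sup>2)\<close> plus a constant, with \<open>u\<^sub>i = L\<^sup>i + \<mu>/n\<close>. For a fixed multiplier
  \<open>\<lambda>\<close> of the constraint \<open>\<Sum>\<^sub>i q\<^sub>i = 1\<close> the problem separates, and coordinate \<open>i\<close> is maximised on
  \<open>[0, \<kappa>]\<close> by clamping \<open>(u\<^sub>i - \<lambda>)/\<mu>\<close> to that interval. If the clamped vector sums to \<open>1\<close>, the
  first-order condition makes it optimal, and strong concavity makes it the only optimum
  (\<open>arg_max_iff_box_response\<close>).

  The derivative \<open>\<theta>'(\<lambda>)\<close> of the dual function is \<open>1\<close> minus the sum of the clamped vector. It is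
  nondecreasing in \<open>\<lambda>\<close> and a combination of ramps \<open>max 0 (s - \<lambda>)\<close> with kinks at the
  breakpoints \<open>s\<close>, hence affine between neighbouring breakpoints. At the least breakpoint every
  coordinate is at its cap and \<open>\<theta>' = 1 - n \<kappa> \<le> 0\<close>; at the greatest one every coordinate is \<open>0\<close>
  and \<open>\<theta>' = 1\<close>. So the breakpoints \<open>a\<close>, \<open>b\<close> of Step 1 exist and are neighbours,
  and the secant of Step 2 hits a zero of \<open>\<theta>'\<close> exactly (\<open>fast_subroutine_box_response\<close>).

  For the running time, the search for \<open>a\<close> and \<open>b\<close> prunes at the median: monotonicity of \<open>\<theta>'\<close>
  settles the sign at no less than half of the undecided breakpoints from its value at the median, and
  the contribution of the breakpoints dropped on the right is affine in \<open>\<lambda>\<close>, so two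
  accumulated sums keep the next evaluation proportional to the surviving list
  (\<open>result_search_tm\<close>). The costs therefore form a geometric series, provided that the median is
  found in linear time (\<open>cost_search_tm_le\<close>). That is the median-of-medians argument: the pivot leaves
  at most about \<open>7/10\<close> of the list on either side and costs a recursive call on \<open>1/5\<close> of it, and
  \<open>7/10 + 1/5 < 1\<close> (\<open>cost_select_tm_le\<close>).
\<close>


section \<open>The dual derivative as a combination of ramps\<close>

text \<open>
  \<open>\<theta>'\<close> in the form in which the search evaluates it: the list \<open>cs\<close> holds pairs of a breakpoint and
  its sign.
\<close>

definition dual_deriv_ramps :: "(real \<times> real) list \<Rightarrow> real \<Rightarrow> real \<Rightarrow> real" where
  "dual_deriv_ramps cs \<mu> x = 1 - (\<Sum>c\<leftarrow>cs. snd c * max 0 (fst c - x)) / \<mu>"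

definition breakpoints :: "real list \<Rightarrow> real \<Rightarrow> real \<Rightarrow> (real \<times> real) list" where
  "breakpoints u \<mu> \<kappa> = map (\<lambda>x. (x, 1)) u @ map (\<lambda>x. (x - \<mu> * \<kappa>, - 1)) u"

text \<open>
  The maximiser of \<open>t * (y - lam) - \<mu>/2 * t\<^sup>2\<close> over \<open>t \<in> [0, \<kappa>]\<close>, for \<open>\<mu> > 0\<close> and \<open>\<kappa> \<ge> 0\<close>.
\<close>

definition box_response :: "real \<Rightarrow> real \<Rightarrow> real \<Rightarrow> real \<Rightarrow> real" where
  "box_response \<mu> \<kappa> lam y = max 0 (min \<kappa> ((y - lam) / \<mu>))"

text \<open>
  Clamping to an interval is the difference of two ramps, one for each end of it. The
  breakpoints and their signs come from here.
\<close>

lemma box_response_conv_ramps: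
  assumes "\<mu> > 0" "\<kappa> \<ge> 0"
  shows "box_response \<mu> \<kappa> x y = (max 0 (y - x) - max 0 (y - \<mu> * \<kappa> - x)) / \<mu>"
proof -
  have "0 \<le> \<mu> * \<kappa>" using assms by simp
  consider "y - \<mu> * \<kappa> \<ge> x" | "y \<ge> x" "y - \<mu> * \<kappa> < x" | "y < x" by linarith
  then show ?thesis
  proof cases
    case 1
    then have "\<kappa> \<le> (y - x) / \<mu>" using assms by (simp add: field_simps)
    moreover have "x \<le> y" using 1 \<open>0 \<le> \<mu> * \<kappa>\<close> by linarith
    ultimately show ?thesis using 1 assms by (simp add: box_response_def)
  next
    case 2
    then have "(y - x) / \<mu> \<le> \<kappa>" "0 \<le> (y - x) / \<mu>" using assms by (simp_all add: field_simps)
    then show ?thesis using 2 assms by (simp add: box_response_def)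
  next
    case 3
    then have "(y - x) / \<mu> \<le> 0" using assms by (simp add: field_simps)
    moreover have "max 0 (y - x) = 0" "max 0 (y - \<mu> * \<kappa> - x) = 0"
      using 3 \<open>0 \<le> \<mu> * \<kappa>\<close> by linarith+
    ultimately show ?thesis using assms by (simp add: box_response_def)
  qed
qed

text \<open>
  The case distinctions of \<open>dual_deriv\<close> and of Step 3 disagree on which branch takes the
  boundary points; the clamped value is continuous there, so both agree with this form.
\<close>

lemma box_response_if:
  assumes "\<mu> > 0" "\<kappa> \<ge> 0"
  shows "box_response \<mu> \<kappa> x y =
    (if x < y - \<mu> * \<kappa> then \<kappa> else if x \<le> y then (y - x) / \<mu> else 0)"
proof -
  have "0 \<le> \<kappa> * \<mu>" using assms by simp
  then show ?thesis
    using assms(1) unfolding box_response_conv_ramps[OF assms] by (auto simp: field_simps)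
qed

lemma dual_deriv_conv_box_response:
  assumes "\<mu> > 0" "\<kappa> \<ge> 0"
  shows "dual_deriv u \<mu> \<kappa> x = 1 - (\<Sum>y\<leftarrow>u. box_response \<mu> \<kappa> x y)"
proof -
  have "(\<Sum>y\<leftarrow>u. box_response \<mu> \<kappa> x y) = (\<Sum>i<length u. box_response \<mu> \<kappa> x (u ! i))"
    by (simp add: sum_list_sum_nth atLeast0LessThan)
  also have "\<dots> = (\<Sum>i<length u. (u ! i - x) / \<mu> * of_bool (u ! i \<ge> x \<and> x \<ge> u ! i - \<mu> * \<kappa>)
                        + \<kappa> * of_bool (u ! i - \<mu> * \<kappa> > x))"
    using assms mult_nonneg_nonneg[of \<mu> \<kappa>] by (intro sum.cong) (auto simp: box_response_if)
  finally show ?thesis by (simp add: dual_deriv_def)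
qed

lemma dual_deriv_conv_breakpoints:
  assumes "\<mu> > 0" "\<kappa> \<ge> 0"
  shows "dual_deriv u \<mu> \<kappa> x = dual_deriv_ramps (breakpoints u \<mu> \<kappa>) \<mu> x"
proof -
  have "(\<Sum>y\<leftarrow>u. box_response \<mu> \<kappa> x y) =
      (\<Sum>c\<leftarrow>breakpoints u \<mu> \<kappa>. snd c * max 0 (fst c - x)) / \<mu>"
    unfolding breakpoints_def
    by (induction u) (simp_all add: box_response_conv_ramps[OF assms] add_divide_distrib diff_divide_distrib)
  then show ?thesis
    by (simp add: dual_deriv_conv_box_response[OF assms] dual_deriv_ramps_def)
qed

lemma mono_dual_deriv:
  assumes "\<mu> > 0" "\<kappa> \<ge> 0" "x \<le> y"
  shows "dual_deriv u \<mu> \<kappa> x \<le> dual_deriv u \<mu> \<kappa> y"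
proof -
  have "box_response \<mu> \<kappa> y z \<le> box_response \<mu> \<kappa> x z" for z
    unfolding box_response_def using assms by (intro max.mono min.mono divide_right_mono) auto
  then show ?thesis
    unfolding dual_deriv_conv_box_response[OF assms(1,2)] by (simp add: sum_list_mono)
qed

text \<open>
  A ramp is affine on every interval that has its kink outside its interior.
\<close>

lemma dual_deriv_ramps_affine_between_breakpoints:
  assumes "a < b" "a \<le> x" "x \<le> b"
    and gap: "\<And>s. s \<in> fst ` set cs \<Longrightarrow> s \<le> a \<or> b \<le> s"
  shows "dual_deriv_ramps cs \<mu> x =
    dual_deriv_ramps cs \<mu> a + (x - a) / (b - a) * (dual_deriv_ramps cs \<mu> b - dual_deriv_ramps cs \<mu> a)"
proof -
  define t where "t = (x - a) / (b - a)"
  have x: "x = a + t * (b - a)" using assms(1) by (simp add: t_def)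
  have ramp: "max 0 (s - x) = max 0 (s - a) + t * (max 0 (s - b) - max 0 (s - a))"
    if "s \<in> fst ` set cs" for s
  proof (cases "s \<le> a")
    case False
    then have "b \<le> s" using gap[OF that] by simp
    then show ?thesis using assms(1-3) unfolding x by (simp add: algebra_simps)
  qed (use assms(1-3) in simp)
  define S where "S y = (\<Sum>c\<leftarrow>cs. snd c * max 0 (fst c - y))" for y
  have "S x = (\<Sum>c\<leftarrow>cs. snd c * max 0 (fst c - a)
      + t * (snd c * max 0 (fst c - b) - snd c * max 0 (fst c - a)))"
    unfolding S_def by (intro arg_cong[of _ _ sum_list] map_cong refl)
      (simp add: ramp algebra_simps)
  also have "\<dots> = S a + t * (S b - S a)"
    unfolding S_def by (simp add: sum_list_addf sum_list_const_mult sum_list_subtractf)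
  finally have affine: "S x = S a + t * (S b - S a)" .
  show ?thesis
    unfolding dual_deriv_ramps_def S_def[symmetric] t_def[symmetric] affine
    by (simp add: diff_divide_distrib add_divide_distrib algebra_simps)
qed


section \<open>Optimality of the output\<close>

text \<open>
  Since \<open>q\<close> and \<open>q'\<close> have the same sum, a linear term \<open>- lam * q\<^sub>i\<close> can be added to each coordinate
  without changing the difference of objectives. Each coordinate is then a concave quadratic
  with curvature \<open>\<mu>\<close>, whose maximum over \<open>[0, cap n p]\<close> is at \<open>q'\<^sub>i\<close>; the squared distance is the
  strong-concavity surplus, which yields uniqueness.
\<close>

lemma objective_le_box_response:
  assumes ls: "length ls = n" "n \<ge> 1" and \<mu>: "\<mu> > 0" and q: "q \<in> feasible n p"
    and len: "length q' = n"
    and q': "\<And>i. i < n \<Longrightarrow> q' ! i = box_response \<mu> (cap n p) lam (ls ! i + \<mu> / real n)"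
    and sum: "(\<Sum>i<n. q' ! i) = 1"
  shows "objective ls \<mu> q + \<mu> / 2 * (\<Sum>i<n. (q' ! i - q ! i)\<^sup>2) \<le> objective ls \<mu> q'"
proof -
  have qlen: "length q = n" and qb: "\<And>i. i < n \<Longrightarrow> 0 \<le> q ! i \<and> q ! i \<le> cap n p"
    and qsum: "(\<Sum>i<n. q ! i) = 1"
    using q by (auto simp: feasible_def prob_simplex_def)
  define g where "g r i = r ! i * (ls ! i + \<mu> / real n - lam) - \<mu> / 2 * (r ! i)\<^sup>2" for r i
  have obj: "objective ls \<mu> r = (\<Sum>i<n. g r i) + lam - n * (\<mu> / (2 * (real n)\<^sup>2))"
    if "length r = n" "(\<Sum>i<n. r ! i) = 1" for r
  proof -
    have "objective ls \<mu> r = (\<Sum>i<n. r ! i * ls ! i - \<mu> * (1/2 * (r ! i - 1 / real n)\<^sup>2))"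
      by (simp add: objective_def dist_uniform_def that(1) ls(1) sum_subtractf sum_distrib_left)
    also have "\<dots> = (\<Sum>i<n. g r i + lam * r ! i - \<mu> / (2 * (real n)\<^sup>2))"
      using ls(2) by (intro sum.cong refl) (simp add: g_def power2_eq_square field_simps)
    also have "\<dots> = (\<Sum>i<n. g r i) + lam - n * (\<mu> / (2 * (real n)\<^sup>2))"
      by (simp add: sum.distrib sum_subtractf sum_distrib_left[symmetric] that(2))
    finally show ?thesis .
  qed
  have pointwise: "g q i + \<mu> / 2 * (q' ! i - q ! i)\<^sup>2 \<le> g q' i" if "i < n" for i
  proof -
    define d where "d = (ls ! i + \<mu> / real n - lam) / \<mu>"
    have d: "ls ! i + \<mu> / real n - lam = \<mu> * d"
      using \<mu> by (simp add: d_def)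
    \<comment> \<open>\<open>q'\<^sub>i\<close> is the projection of \<open>d\<close> onto \<open>[0, cap n p]\<close>; the variational inequality of this projection follows.\<close>
    have "q' ! i = max 0 (min (cap n p) d)"
      using q'[OF that] by (simp add: box_response_def d_def)
    then have "0 \<le> (q' ! i - q ! i) * (d - q' ! i)"
      using qb[OF that] by (auto simp: max_def min_def mult_nonpos_nonpos zero_le_mult_iff)
    then have "0 \<le> \<mu> * ((q' ! i - q ! i) * (d - q' ! i))"
      using \<mu> by simp
    then show ?thesis
      unfolding g_def d by (simp add: power2_eq_square algebra_simps)
  qed
  have "(\<Sum>i<n. g q i) + \<mu> / 2 * (\<Sum>i<n. (q' ! i - q ! i)\<^sup>2) \<le> (\<Sum>i<n. g q' i)"
    unfolding sum_distrib_left sum.distrib[symmetric] by (intro sum_mono pointwise) simp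
  then show ?thesis
    unfolding obj[OF qlen qsum] obj[OF len sum] by simp
qed

lemma arg_max_iff_box_response:
  assumes ls: "length ls = n" "n \<ge> 1" and \<mu>: "\<mu> > 0" and cap: "cap n p \<ge> 0"
    and len: "length q' = n"
    and q': "\<And>i. i < n \<Longrightarrow> q' ! i = box_response \<mu> (cap n p) lam (ls ! i + \<mu> / real n)"
    and sum: "(\<Sum>i<n. q' ! i) = 1"
  shows "is_arg_max (objective ls \<mu>) (\<lambda>q. q \<in> feasible n p) q \<longleftrightarrow> q = q'"
proof -
  have feas: "q' \<in> feasible n p"
    using len q' sum cap by (auto simp: feasible_def prob_simplex_def box_response_def)
  note le = objective_le_box_response[OF ls \<mu> _ len q' sum]
  have nonneg: "0 \<le> \<mu> / 2 * (\<Sum>i<n. (q' ! i - r ! i)\<^sup>2)" for r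
    using \<mu> by (intro mult_nonneg_nonneg sum_nonneg) auto
  show ?thesis
  proof
    assume max: "is_arg_max (objective ls \<mu>) (\<lambda>q. q \<in> feasible n p) q"
    then have q: "q \<in> feasible n p" and "\<not> objective ls \<mu> q < objective ls \<mu> q'"
      using feas by (auto simp: is_arg_max_def)
    with le[OF q] have "\<mu> / 2 * (\<Sum>i<n. (q' ! i - q ! i)\<^sup>2) \<le> 0"
      by simp
    then have "(\<Sum>i<n. (q' ! i - q ! i)\<^sup>2) = 0"
      using \<mu> by (intro antisym sum_nonneg) (auto simp: mult_le_0_iff)
    then have "\<forall>i<n. q' ! i = q ! i"
      by (subst (asm) sum_nonneg_eq_0_iff) auto
    then show "q = q'"
      using q len by (intro nth_equalityI) (auto simp: feasible_def prob_simplex_def)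
  next
    assume "q = q'"
    moreover have "objective ls \<mu> r \<le> objective ls \<mu> q'" if "r \<in> feasible n p" for r
      using le[OF that] nonneg[of r] by linarith
    ultimately show "is_arg_max (objective ls \<mu>) (\<lambda>q. q \<in> feasible n p) q"
      using feas by (auto simp: is_arg_max_def not_less)
  qed
qed

text \<open>
  The existence of \<open>a\<close> and \<open>b\<close>, and exactness of the interpolation step: \<open>a\<close> and \<open>b\<close> are
  neighbouring breakpoints because \<open>\<theta>'\<close> has a sign at each breakpoint and is monotone. The nonemptiness
  of the two candidate sets is kept for the program, whose search falls back on
  placeholders otherwise.
\<close>

lemma fast_subroutine_box_response:
  assumes n: "length ls = n" "n \<ge> 1" and p: "0 \<le> p" "p < 1" and \<mu>: "0 < \<mu>"
  defines "\<kappa> \<equiv> cap n p" and "u \<equiv> map (\<lambda>x. x + \<mu> / real n) ls"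
  defines "P \<equiv> fst ` set (breakpoints u \<mu> \<kappa>)"
  obtains lam where "fast_subroutine ls \<mu> p = map (box_response \<mu> \<kappa> lam) u"
    and "dual_deriv u \<mu> \<kappa> lam = 0"
    and "{s \<in> P. dual_deriv u \<mu> \<kappa> s \<le> 0} \<noteq> {}" "{s \<in> P. dual_deriv u \<mu> \<kappa> s > 0} \<noteq> {}"
proof -
  define f where "f = dual_deriv u \<mu> \<kappa>"
  have \<kappa>: "\<kappa> > 0" "real n * \<kappa> \<ge> 1"
    using n p by (simp_all add: \<kappa>_def cap_def field_simps)
  have \<kappa>0: "\<kappa> \<ge> 0" using \<kappa> by simp
  have u: "u \<noteq> []" "length u = n"
    using n by (auto simp: u_def)
  have P: "P = set u \<union> (\<lambda>x. x - \<mu> * \<kappa>) ` set u" "finite P"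
    by (auto simp: P_def breakpoints_def image_Un image_image)
  \<comment> \<open>The extreme breakpoints witness both signs of \<open>\<theta>'\<close>.\<close>
  define lo where "lo = Min (set u) - \<mu> * \<kappa>"
  have "Min (set u) \<in> set u" "Max (set u) \<in> set u"
    using u by simp_all
  then have ends: "lo \<in> P" "Max (set u) \<in> P"
    by (auto simp: P lo_def)
  have "box_response \<mu> \<kappa> lo y = \<kappa>" if "y \<in> set u" for y
  proof -
    have "Min (set u) \<le> y" using that by simp
    then have "\<kappa> \<le> (y - lo) / \<mu>" using \<mu> by (simp add: lo_def field_simps)
    then show ?thesis using \<kappa> by (simp add: box_response_def)
  qed
  then have "f lo = 1 - real n * \<kappa>"
    unfolding f_def dual_deriv_conv_box_response[OF \<mu> \<kappa>0]
    using u by (simp add: sum_list_triv cong: map_cong)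
  with \<kappa> have lo: "f lo \<le> 0" by simp
  have "box_response \<mu> \<kappa> (Max (set u)) y = 0" if "y \<in> set u" for y
  proof -
    have "(y - Max (set u)) / \<mu> \<le> 0" using that \<mu> by (simp add: divide_nonpos_pos)
    then show ?thesis by (simp add: box_response_def)
  qed
  then have "f (Max (set u)) = 1"
    unfolding f_def dual_deriv_conv_box_response[OF \<mu> \<kappa>0] by (simp cong: map_cong)
  then have hi: "f (Max (set u)) > 0" by simp
  define S where "S = {s \<in> P. f s \<le> 0}"
  define T where "T = {s \<in> P. f s > 0}"
  have fin: "finite S" "finite T" and ne: "S \<noteq> {}" "T \<noteq> {}"
    using P(2) lo hi ends by (auto simp: S_def T_def)
  define a where "a = Max S"
  define b where "b = Min T"
  have a: "f a \<le> 0" and b: "f b > 0"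
    using Max_in[OF fin(1) ne(1)] Min_in[OF fin(2) ne(2)] by (auto simp: a_def b_def S_def T_def)
  have "a < b"
    using mono_dual_deriv[OF \<mu> \<kappa>0, of b a u] a b unfolding f_def by linarith
  have gap: "s \<le> a \<or> b \<le> s" if "s \<in> P" for s
  proof (cases "f s \<le> 0")
    case True
    then show ?thesis using that fin by (auto simp: a_def S_def)
  next
    case False
    then show ?thesis using that fin by (auto simp: b_def T_def)
  qed
  define lam where "lam = a - f a * (b - a) / (f b - f a)"
  have frac: "(lam - a) / (b - a) = - f a / (f b - f a)"
    using \<open>a < b\<close> by (simp add: lam_def)
  have "0 \<le> - f a / (f b - f a)" "- f a / (f b - f a) \<le> 1"
    using a b by (simp_all add: divide_nonpos_pos pos_le_divide_eq)
  then have "a \<le> lam" "lam \<le> b"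
    unfolding frac[symmetric] using \<open>a < b\<close> by (simp_all add: zero_le_divide_iff pos_divide_le_eq)
  then have "f lam = f a + (lam - a) / (b - a) * (f b - f a)"
    unfolding f_def dual_deriv_conv_breakpoints[OF \<mu> \<kappa>0]
    by (intro dual_deriv_ramps_affine_between_breakpoints \<open>a < b\<close>) (use gap in \<open>auto simp: P_def\<close>)
  also have "\<dots> = 0"
    unfolding frac using a b by simp
  finally have zero: "f lam = 0" .
  have "fast_subroutine ls \<mu> p = map (\<lambda>x. if lam < x - \<mu> * \<kappa> then \<kappa>
                 else if x - \<mu> * \<kappa> \<le> lam \<and> lam < x then (x - lam) / \<mu> else 0) u"
    unfolding fast_subroutine_def Let_def n(1) u_def[symmetric] \<kappa>_def[symmetric] P(1)[symmetric]
      f_def[symmetric] S_def[symmetric] T_def[symmetric] a_def[symmetric] b_def[symmetric]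
      lam_def[symmetric] by simp
  also have "\<dots> = map (box_response \<mu> \<kappa> lam) u"
    by (auto simp: box_response_if[OF \<mu> \<kappa>0])
  finally show ?thesis
    using that zero ne unfolding S_def T_def f_def by blast
qed

lemma fast_subroutine_optimal:
  assumes "length ls = n" "n \<ge> 1" "0 \<le> p" "p < 1" "0 < \<mu>"
  shows "is_arg_max (objective ls \<mu>) (\<lambda>q. q \<in> feasible n p) q \<longleftrightarrow> q = fast_subroutine ls \<mu> p"
proof -
  have cap: "cap n p \<ge> 0"
    using assms by (simp add: cap_def)
  let ?q = "fast_subroutine ls \<mu> p" and ?u = "map (\<lambda>x. x + \<mu> / real n) ls"
  from fast_subroutine_box_response[OF assms] obtain lam
    where q: "?q = map (box_response \<mu> (cap n p) lam) ?u"
    and zero: "dual_deriv ?u \<mu> (cap n p) lam = 0"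
    by blast
  show ?thesis
  proof (rule arg_max_iff_box_response[OF assms(1,2,5) cap])
    show "length ?q = n" and "\<And>i. i < n \<Longrightarrow> ?q ! i = box_response \<mu> (cap n p) lam (ls ! i + \<mu> / real n)"
      by (simp_all add: q assms(1))
    have "(\<Sum>i<n. ?q ! i) = sum_list ?q"
      by (simp add: sum_list_sum_nth q assms(1) atLeast0LessThan)
    also have "\<dots> = 1"
      using zero unfolding dual_deriv_conv_box_response[OF assms(5) cap] q by simp
    finally show "(\<Sum>i<n. ?q ! i) = 1" .
  qed
qed


section \<open>Costs and results of the list operations\<close>


lemma cost_length_tm: "cost (length_tm xs) = 2 * length xs + 1"
  by (induction xs) auto

lemma cost_append_tm: "cost (append_tm xs ys) = 2 * length xs + 1"
  by (induction xs) auto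

lemma result_append_tm: "result (append_tm xs ys) = xs @ ys"
  by (induction xs) auto

lemma result_sum_tm: "result (sum_tm f xs) = (\<Sum>x\<leftarrow>xs. result (f x))"
  by (induction xs) auto

lemma cost_nth_tm_le: "cost (nth_tm xs k) \<le> length xs + 1"
  by (induction xs k rule: nth_tm.induct) auto

lemma cost_map_list_tm_le:
  assumes "\<And>x. cost (f x) \<le> c"
  shows "cost (map_list_tm f xs) \<le> (c + 2) * length xs + 1"
proof (induction xs)
  case (Cons x xs)
  then show ?case using assms[of x] by simp
qed simp

lemma cost_sum_tm_le:
  assumes "\<And>x. cost (f x) \<le> c"
  shows "cost (sum_tm f xs) \<le> (c + 2) * length xs + 1"
proof (induction xs)
  case (Cons x xs)
  then show ?case using assms[of x] by simp
qed simp

lemma cost_filter_tm_le: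
  assumes "\<And>x. cost (f x) \<le> c"
  shows "cost (filter_tm f xs) \<le> (c + 2) * length xs + 1"
proof (induction xs)
  case (Cons x xs)
  then show ?case using assms[of x] by simp
qed simp

lemma cost_insort_tm_le: "cost (insort_tm x xs) \<le> 3 * length xs + 2"
  by (induction xs) auto

text \<open>
  The quadratic bound is only ever applied to lists of bounded length: the groups of five and
  the base case of the selection.
\<close>

lemma cost_isort_tm_le: "cost (isort_tm xs) \<le> length xs * (3 * length xs + 3) + 1"
proof (induction xs)
  case (Cons x xs)
  have "cost (insort_tm x (result (isort_tm xs))) \<le> 3 * length xs + 2"
    using cost_insort_tm_le[of x "result (isort_tm xs)"] by simp
  then show ?case using Cons by (simp add: algebra_simps)
qed simp

lemma set_insort_tm: "set (result (insort_tm x xs)) = insert x (set xs)"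
  by (metis mset_insort_tm set_mset_add_mset_insert set_mset_mset)

lemma sorted_insort_tm: "sorted xs \<Longrightarrow> sorted (result (insort_tm x xs))"
  by (induction xs) (auto simp: set_insort_tm)

lemma sorted_isort_tm: "sorted (result (isort_tm xs))"
  by (induction xs) (auto simp: sorted_insort_tm)

lemma length_filter_cong_mset: "mset xs = mset ys \<Longrightarrow> length (filter P xs) = length (filter P ys)"
  by (metis mset_filter size_mset)


section \<open>Median of medians\<close>

lemma cost_medians5_tm_le: "cost (medians5_tm xs) \<le> 21 * length xs + 1"
proof (induction xs rule: medians5_tm.induct)
  case (1 x1 x2 x3 x4 x5 xs)
  define ys where "ys = isort_tm [x1, x2, x3, x4, x5]"
  have "cost ys \<le> 91"
    using cost_isort_tm_le[of "[x1, x2, x3, x4, x5]"] unfolding ys_def by (simp del: isort_tm.simps)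
  moreover have "cost (nth_tm (result ys) 2) \<le> 6"
    using cost_nth_tm_le[of "result ys" 2] unfolding ys_def by (simp del: isort_tm.simps)
  ultimately show ?case
    using 1[OF refl refl refl refl] by (simp add: ys_def del: isort_tm.simps)
qed simp_all

text \<open>
  If the median of a group of five satisfies an upward or downward closed property, so do the two
  elements of the group on the corresponding side.
\<close>

lemma medians5_tm_majority:
  fixes Q :: "real \<Rightarrow> bool"
  assumes Q: "(\<forall>x y. x \<le> y \<longrightarrow> Q x \<longrightarrow> Q y) \<or> (\<forall>x y. x \<le> y \<longrightarrow> Q y \<longrightarrow> Q x)"
  shows "3 * length (filter Q (result (medians5_tm xs))) \<le> length (filter Q xs)"
proof (induction xs rule: medians5_tm.induct)
  case (1 x1 x2 x3 x4 x5 xs)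
  define ys where "ys = result (isort_tm [x1, x2, x3, x4, x5])"
  have "length ys = 5"
    unfolding ys_def by (simp del: isort_tm.simps)
  then obtain y1 y2 y3 y4 y5 where ys: "ys = [y1, y2, y3, y4, y5]"
    by (auto simp: numeral_eq_Suc length_Suc_conv)
  have "sorted ys"
    unfolding ys_def by (rule sorted_isort_tm)
  then have "y1 \<le> y2" "y2 \<le> y3" "y3 \<le> y4" "y4 \<le> y5"
    unfolding ys by auto
  with Q have "Q y3 \<Longrightarrow> Q y1 \<and> Q y2 \<or> Q y4 \<and> Q y5"
    by (meson order_trans)
  then have "3 * of_bool (Q y3) \<le> length (filter Q ys)"
    unfolding ys by auto
  also have "\<dots> = length (filter Q [x1, x2, x3, x4, x5])"
    unfolding ys_def by (intro length_filter_cong_mset mset_isort_tm)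
  finally have group: "3 * of_bool (Q y3) \<le> length (filter Q [x1, x2, x3, x4, x5])" .
  define ms where "ms = result (medians5_tm xs)"
  have "result (medians5_tm (x1 # x2 # x3 # x4 # x5 # xs)) = y3 # ms"
    using ys by (simp add: ys_def ms_def numeral_2_eq_2 del: isort_tm.simps)
  then have "3 * length (filter Q (result (medians5_tm (x1 # x2 # x3 # x4 # x5 # xs)))) =
      3 * of_bool (Q y3) + 3 * length (filter Q ms)"
    by simp
  also have "\<dots> \<le> length (filter Q [x1, x2, x3, x4, x5]) + length (filter Q xs)"
    using 1[OF refl refl refl refl] group unfolding ms_def by (rule add_mono[rotated])
  also have "\<dots> = length (filter Q (x1 # x2 # x3 # x4 # x5 # xs))"
    by simp
  finally show ?case .
qed simp_all

text \<open>
  Counting both strict and weak predecessors describes rank in lists with repetitions and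
  refers to no sorted copy of the list.
\<close>

definition has_rank :: "nat \<Rightarrow> real list \<Rightarrow> real \<Rightarrow> bool" where
  "has_rank k xs r \<longleftrightarrow>
     length (filter (\<lambda>x. x < r) xs) \<le> k \<and> k < length (filter (\<lambda>x. x \<le> r) xs)"

lemma has_rank_nth_sorted:
  assumes "sorted xs" "k < length xs"
  shows "has_rank k xs (xs ! k)"
proof -
  have split: "xs = take k xs @ drop k xs" by simp
  have "filter (\<lambda>x. x < xs ! k) (drop k xs) = []"
    using assms by (auto simp: filter_empty_conv in_set_conv_nth sorted_nth_mono not_less)
  then have "filter (\<lambda>x. x < xs ! k) xs = filter (\<lambda>x. x < xs ! k) (take k xs)"
    by (subst split) (simp only: filter_append append_Nil2)
  then have 1: "length (filter (\<lambda>x. x < xs ! k) xs) \<le> k"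
    using length_filter_le[of _ "take k xs"] by (metis length_take min.boundedE)
  have split': "xs = take (Suc k) xs @ drop (Suc k) xs" by simp
  have "filter (\<lambda>x. x \<le> xs ! k) (take (Suc k) xs) = take (Suc k) xs"
    using assms by (auto simp: filter_id_conv in_set_conv_nth less_Suc_eq_le sorted_nth_mono)
  then have "filter (\<lambda>x. x \<le> xs ! k) xs
      = take (Suc k) xs @ filter (\<lambda>x. x \<le> xs ! k) (drop (Suc k) xs)"
    by (metis split' filter_append)
  then have "k < length (filter (\<lambda>x. x \<le> xs ! k) xs)"
    using assms(2) by simp
  with 1 show ?thesis by (simp add: has_rank_def)
qed

text \<open>
  The pivot used by \<open>select_tm\<close> on lists of more than \<open>20\<close> elements.
\<close>

definition pivot :: "real list \<Rightarrow> real" where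
  "pivot xs = (let ms = result (medians5_tm xs) in result (select_tm (length ms div 2) ms))"

lemma result_select_tm_rec:
  "result (select_tm k xs) =
    (if length xs \<le> 20 then result (nth_tm (result (isort_tm xs)) k)
     else let m = pivot xs; lts = filter (\<lambda>x. x < m) xs; gts = filter (\<lambda>x. x > m) xs;
              nle = length lts + length (filter (\<lambda>x. x = m) xs)
          in if k < length lts then result (select_tm k lts)
             else if k < nle then m
             else result (select_tm (k - nle) gts))"
  by (subst select_tm.simps) (simp add: pivot_def Let_def)

lemma length_filter_le_conv:
  fixes m :: real
  shows "length (filter (\<lambda>x. x \<le> m) xs) =
    length (filter (\<lambda>x. x < m) xs) + length (filter (\<lambda>x. x = m) xs)"
  by (induction xs) auto

text \<open>
  A recursive call works on one side of the pivot. On the left the counts are unchanged, since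
  everything below the result is below the pivot; on the right both counts drop by the number of
  elements up to the pivot, which is the amount subtracted from \<open>k\<close>.
\<close>

lemma has_rank_select_tm: "k < length xs \<Longrightarrow> has_rank k xs (result (select_tm k xs))"
proof (induction xs arbitrary: k rule: measure_induct_rule[of length])
  case (less xs)
  show ?case
  proof (cases "length xs \<le> 20")
    case True
    have "has_rank k (result (isort_tm xs)) (result (isort_tm xs) ! k)"
      using less.prems by (intro has_rank_nth_sorted sorted_isort_tm) simp
    then have "has_rank k xs (result (isort_tm xs) ! k)"
      unfolding has_rank_def using length_filter_cong_mset[OF mset_isort_tm[of xs]] by simp
    then show ?thesis
      using True less.prems by (simp add: result_select_tm_rec)
  next
    case False
    define m where "m = pivot xs"
    define lts where "lts = filter (\<lambda>x. x < m) xs"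
    define gts where "gts = filter (\<lambda>x. x > m) xs"
    define nle where "nle = length lts + length (filter (\<lambda>x. x = m) xs)"
    have "m \<in> set xs"
      unfolding m_def pivot_def Let_def using False by (intro pivot_in_set select_tm_total)
    then have shorter: "length lts < length xs" "length gts < length xs"
      unfolding lts_def gts_def by (auto intro: filter_length_less)
    have nle: "nle = length (filter (\<lambda>x. x \<le> m) xs)"
      by (simp add: nle_def lts_def length_filter_le_conv)
    have len: "length xs = nle + length gts"
      using length_filter_three[of m xs] by (simp add: nle_def lts_def gts_def)
    have sel: "result (select_tm k xs) =
      (if k < length lts then result (select_tm k lts)
       else if k < nle then m else result (select_tm (k - nle) gts))"
      using False by (subst result_select_tm_rec)
        (simp add: Let_def m_def lts_def gts_def nle_def)
    consider "k < length lts" | "\<not> k < length lts" "k < nle" | "\<not> k < length lts" "\<not> k < nle"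
      by blast
    then show ?thesis
    proof cases
      case 1
      define r where "r = result (select_tm k lts)"
      have "r < m"
        using select_tm_in_set[OF 1] by (auto simp: r_def lts_def)
      have "filter (\<lambda>x. x < r) lts = filter (\<lambda>x. x < r) xs"
        "filter (\<lambda>x. x \<le> r) lts = filter (\<lambda>x. x \<le> r) xs"
        using \<open>r < m\<close> by (auto simp: lts_def intro!: filter_cong)
      with less.IH[OF shorter(1) 1] sel 1 show ?thesis
        by (simp add: has_rank_def r_def)
    next
      case 2
      then show ?thesis
        unfolding sel has_rank_def nle lts_def by simp
    next
      case 3
      define r where "r = result (select_tm (k - nle) gts)"
      have k: "k - nle < length gts"
        using 3 less.prems len by linarith
      have "r > m"
        using select_tm_in_set[OF k] by (auto simp: r_def gts_def)
      then have "length (filter (\<lambda>x. x < r) xs) = nle + length (filter (\<lambda>x. x < r) gts)"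
        "length (filter (\<lambda>x. x \<le> r) xs) = nle + length (filter (\<lambda>x. x \<le> r) gts)"
        unfolding nle gts_def by (induction xs) auto
      with less.IH[OF shorter(2) k] sel 3 show ?thesis
        by (simp add: has_rank_def r_def) linarith
    qed
  qed
qed

text \<open>
  With \<open>g\<close> groups, at least \<open>g/2\<close> medians lie weakly on either side of the pivot, and each
  accounts for three elements there, so at least \<open>3g/2 \<ge> 3/10 (length xs - 4)\<close> elements escape
  the opposite side. The additive \<open>12\<close> pays for the incomplete last group.
\<close>

lemma length_filter_pivot_le:
  assumes "length xs > 20"
  shows "10 * length (filter (\<lambda>x. x < pivot xs) xs) \<le> 7 * length xs + 12"
    and "10 * length (filter (\<lambda>x. x > pivot xs) xs) \<le> 7 * length xs + 12"
proof -
  define m where "m = pivot xs"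
  define ms where "ms = result (medians5_tm xs)"
  define g where "g = length ms"
  have g: "g = length xs div 5" by (simp add: g_def ms_def)
  then have "has_rank (g div 2) ms m"
    using assms unfolding m_def pivot_def Let_def ms_def[symmetric] g_def[symmetric]
    by (intro has_rank_select_tm) (auto simp: g_def)
  then have rank: "length (filter (\<lambda>x. x < m) ms) \<le> g div 2" "g div 2 < length (filter (\<lambda>x. x \<le> m) ms)"
    by (simp_all add: has_rank_def)
  have "3 * length (filter (\<lambda>x. x \<ge> m) ms) \<le> length (filter (\<lambda>x. x \<ge> m) xs)"
    "3 * length (filter (\<lambda>x. x \<le> m) ms) \<le> length (filter (\<lambda>x. x \<le> m) xs)"
    unfolding ms_def by (rule medians5_tm_majority, force)+
  moreover have "length (filter (\<lambda>x. x < m) ys) + length (filter (\<lambda>x. x \<ge> m) ys) = length ys"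
    "length (filter (\<lambda>x. x > m) ys) + length (filter (\<lambda>x. x \<le> m) ys) = length ys" for ys
    by (induction ys) auto
  note this[of xs] this[of ms]
  ultimately show "10 * length (filter (\<lambda>x. x < pivot xs) xs) \<le> 7 * length xs + 12"
    "10 * length (filter (\<lambda>x. x > pivot xs) xs) \<le> 7 * length xs + 12"
    using rank g unfolding m_def[symmetric] g_def[symmetric] by linarith+
qed

text \<open>
  For \<open>n > 20\<close> the recursion costs at most \<open>39 n\<close> plus a call on \<open>n/5\<close> and one on \<open>(7n + 12)/10\<close>
  elements. The slope \<open>C\<close> and offset \<open>D\<close> of a linear bound must satisfy
  \<open>D + 39 n \<le> C (n - 12)/10\<close>. The bound for the base case is just below \<open>D = 1400\<close>, the worst case is
  \<open>n = 21\<close>, and \<open>C = 2500\<close> is enough.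
\<close>

lemma cost_select_tm_le: "cost (select_tm k xs) \<le> 2500 * length xs + 1400"
proof (induction xs arbitrary: k rule: measure_induct_rule[of length])
  case (less xs)
  define n where "n = length xs"
  show ?case
  proof (cases "n \<le> 20")
    case True
    have "cost (isort_tm xs) \<le> n * (3 * n + 3) + 1"
      unfolding n_def by (rule cost_isort_tm_le)
    also have "\<dots> \<le> 20 * (3 * 20 + 3) + 1"
      using True by (intro add_mono mult_mono) auto
    finally have "cost (isort_tm xs) \<le> 1261" by simp
    moreover have "cost (nth_tm (result (isort_tm xs)) k) \<le> 21"
      using cost_nth_tm_le[of "result (isort_tm xs)" k] True by (simp add: n_def)
    ultimately show ?thesis
      using True by (subst select_tm.simps) (simp add: cost_length_tm n_def)
  next
    case False
    define m where "m = pivot xs"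
    define ms where "ms = result (medians5_tm xs)"
    define lts where "lts = filter (\<lambda>x. x < m) xs"
    define eqs where "eqs = filter (\<lambda>x. x = m) xs"
    define gts where "gts = filter (\<lambda>x. x > m) xs"
    define k' where "k' = k - (length lts + length eqs)"
    have m: "m = result (select_tm (length ms div 2) ms)"
      by (simp add: m_def pivot_def ms_def)
    have ms_len: "5 * length ms \<le> n"
      by (simp add: ms_def n_def)
    have lts_len: "10 * length lts \<le> 7 * n + 12" and gts_len: "10 * length gts \<le> 7 * n + 12"
      unfolding lts_def gts_def m_def n_def using False
      by (intro length_filter_pivot_le; simp add: n_def)+
    have len: "length lts + length eqs + length gts = n"
      unfolding lts_def gts_def eqs_def n_def by (rule length_filter_three)
    have sub: "cost (select_tm (length ms div 2) ms) \<le> 2500 * length ms + 1400"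
      by (rule less.IH) (use ms_len False in \<open>simp add: n_def\<close>)
    have left: "cost (select_tm k lts) \<le> 2500 * length lts + 1400"
      by (rule less.IH) (use lts_len False in \<open>simp add: n_def\<close>)
    have right: "cost (select_tm k' gts) \<le> 2500 * length gts + 1400"
      by (rule less.IH) (use gts_len False in \<open>simp add: n_def\<close>)
    have filters: "cost (filter_tm (\<lambda>x. op1 (Q x)) xs) \<le> 3 * n + 1" for Q
      using cost_filter_tm_le[of "\<lambda>x. op1 (Q x)" 1 xs] by (simp add: n_def)
    have "cost (select_tm k xs) =
        cost (medians5_tm xs) + cost (select_tm (length ms div 2) ms)
        + cost (filter_tm (\<lambda>x. op1 (x < m)) xs) + cost (filter_tm (\<lambda>x. op1 (x = m)) xs)
        + cost (filter_tm (\<lambda>x. op1 (x > m)) xs)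
        + (2 * n + 2 * length ms + 2 * length lts + 2 * length eqs + 9)
        + (if k < length lts then cost (select_tm k lts)
           else if k < length lts + length eqs then 1
           else 2 + cost (select_tm k' gts))"
      using False
      by (subst select_tm.simps)
        (simp add: cost_length_tm n_def ms_def[symmetric] m[symmetric] lts_def[symmetric]
          eqs_def[symmetric] gts_def[symmetric] k'_def[symmetric] del: length_medians5_tm)
    then have "cost (select_tm k xs) \<le> 2500 * length ms + 39 * n + 1400
        + max (2500 * length lts) (2500 * length gts) + 1400"
      using sub left right filters[of "\<lambda>x. x < m"] filters[of "\<lambda>x. x = m"]
        filters[of "\<lambda>x. x > m"] cost_medians5_tm_le[of xs, folded n_def] len ms_len False
      by (auto split: if_splits)
    then show ?thesis
      using lts_len gts_len ms_len False unfolding n_def[symmetric] by linarith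
  qed
qed


section \<open>Search for the sign change by pruning at medians\<close>

definition moment :: "(real \<times> real) list \<Rightarrow> real" where
  "moment cs = (\<Sum>c\<leftarrow>cs. snd c * fst c)"

definition weight :: "(real \<times> real) list \<Rightarrow> real" where
  "weight cs = (\<Sum>c\<leftarrow>cs. snd c)"

definition median_breakpoint :: "(real \<times> real) list \<Rightarrow> real" where
  "median_breakpoint cs = result (select_tm (length cs div 2) (map fst cs))"

text \<open>
  The value that \<open>search_tm\<close> computes at \<open>x\<close>: the discarded breakpoints enter through the sums
  \<open>A\<close> and \<open>B\<close>, the undecided ones to the right of \<open>x\<close> are summed directly.
\<close>

definition partial_dual_deriv :: "real \<Rightarrow> (real \<times> real) list \<Rightarrow> real \<Rightarrow> real \<Rightarrow> real \<Rightarrow> real" where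
  "partial_dual_deriv \<mu> cs A B x =
     1 - ((A + moment (filter (\<lambda>c. fst c > x) cs)) - (B + weight (filter (\<lambda>c. fst c > x) cs)) * x) / \<mu>"

lemma result_search_tm_rec:
  "result (search_tm \<mu> cs A B lo hi) =
    (if cs = [] then (lo, hi)
     else let m = median_breakpoint cs;
              gts = filter (\<lambda>c. fst c > m) cs;
              eqs = filter (\<lambda>c. fst c = m) cs;
              lts = filter (\<lambda>c. fst c < m) cs
          in if partial_dual_deriv \<mu> cs A B m \<le> 0 then result (search_tm \<mu> gts A B m hi)
             else result (search_tm \<mu> lts (A + moment gts + moment eqs) (B + weight gts + weight eqs) lo m))"
  by (subst search_tm.simps)
    (simp add: median_breakpoint_def Let_def partial_dual_deriv_def moment_def weight_def result_sum_tm case_prod_beta)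

lemma median_breakpoint_in_set: "cs \<noteq> [] \<Longrightarrow> median_breakpoint cs \<in> fst ` set cs"
  using select_tm_in_set[of "length cs div 2" "map fst cs"] by (simp add: median_breakpoint_def)

text \<open>
  The step that justifies updating \<open>A\<close> and \<open>B\<close> when the breakpoints from \<open>m\<close> upwards are dropped.
\<close>

lemma moment_weight_right_of_split:
  assumes "s < m"
  shows "moment (filter (\<lambda>c. fst c > s) cs) = moment (filter (\<lambda>c. fst c > s) (filter (\<lambda>c. fst c < m) cs))
      + (moment (filter (\<lambda>c. fst c > m) cs) + moment (filter (\<lambda>c. fst c = m) cs))"
    "weight (filter (\<lambda>c. fst c > s) cs) = weight (filter (\<lambda>c. fst c > s) (filter (\<lambda>c. fst c < m) cs))
      + (weight (filter (\<lambda>c. fst c > m) cs) + weight (filter (\<lambda>c. fst c = m) cs))"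
  using assms unfolding moment_def weight_def by (induction cs) auto

text \<open>
  The values \<open>lo\<close> and \<open>hi\<close> are returned only if the undecided list contributes no candidate
  of the respective sign; hence the placeholders of the first call never surface. The invariant
  is that the accumulated sums give the correct value of \<open>f\<close> at every undecided breakpoint;
  monotonicity of \<open>f\<close> ensures that the dropped side has no candidate of the opposite sign.
\<close>

lemma result_search_tm:
  assumes "mono f"
    and "\<And>s. s \<in> fst ` set cs \<Longrightarrow> f s = partial_dual_deriv \<mu> cs A B s"
  shows "result (search_tm \<mu> cs A B lo hi) =
    (let S = {s \<in> fst ` set cs. f s \<le> 0}; T = {s \<in> fst ` set cs. f s > 0}
     in (if S = {} then lo else Max S, if T = {} then hi else Min T))"
  using assms(2)
proof (induction cs arbitrary: A B lo hi rule: measure_induct_rule[of length])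
  case (less cs)
  show ?case
  proof (cases "cs = []")
    case True
    then show ?thesis by (simp add: result_search_tm_rec)
  next
    case False
    define m where "m = median_breakpoint cs"
    define gts where "gts = filter (\<lambda>c. fst c > m) cs"
    define eqs where "eqs = filter (\<lambda>c. fst c = m) cs"
    define lts where "lts = filter (\<lambda>c. fst c < m) cs"
    define P where "P = fst ` set cs"
    have m: "m \<in> P"
      using median_breakpoint_in_set[OF False] by (simp add: m_def P_def)
    have [simp]: "finite P"
      by (simp add: P_def)
    have parts: "fst ` set gts = {s \<in> P. s > m}" "fst ` set lts = {s \<in> P. s < m}"
      unfolding P_def gts_def lts_def by auto
    have shorter: "length gts < length cs" "length lts < length cs"
      using m unfolding gts_def lts_def P_def by (auto intro: filter_length_less)
    have fm: "f m = partial_dual_deriv \<mu> cs A B m"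
      using less.prems m by (simp add: P_def)
    have rec: "result (search_tm \<mu> cs A B lo hi) =
      (if f m \<le> 0 then result (search_tm \<mu> gts A B m hi)
       else result (search_tm \<mu> lts (A + moment gts + moment eqs) (B + weight gts + weight eqs) lo m))"
      using False unfolding fm
      by (subst result_search_tm_rec) (simp add: Let_def m_def gts_def eqs_def lts_def)
    show ?thesis
    proof (cases "f m \<le> 0")
      case True
      have "f s = partial_dual_deriv \<mu> gts A B s" if "s \<in> fst ` set gts" for s
      proof -
        have "filter (\<lambda>c. fst c > s) cs = filter (\<lambda>c. fst c > s) gts"
          using that unfolding gts_def by (auto intro!: filter_cong)
        then show ?thesis
          using less.prems[of s] that parts by (simp add: partial_dual_deriv_def P_def)
      qed
      note slope = this
      define S where "S = {s \<in> P. s > m \<and> f s \<le> 0}"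
      have IH: "result (search_tm \<mu> gts A B m hi) =
          (if S = {} then m else Max S,
           if {s \<in> P. s > m \<and> f s > 0} = {} then hi else Min {s \<in> P. s > m \<and> f s > 0})"
        using less.IH[OF shorter(1), of A B m hi] slope
        unfolding parts Let_def S_def by (simp add: conj_assoc del: Collect_empty_eq)
      \<comment> \<open>Every candidate for \<open>b\<close> survives, and \<open>m\<close> beats every dropped candidate for \<open>a\<close>.\<close>
      have "{s \<in> P. f s > 0} = {s \<in> P. s > m \<and> f s > 0}"
        using True monoD[OF assms(1)] by (fastforce simp: not_less[symmetric])
      moreover have "Max {s \<in> P. f s \<le> 0} = (if S = {} then m else Max S)"
      proof -
        have "Max {s \<in> P. f s \<le> 0} = Max (insert m S)"
        proof (rule Max_eqI)
          show "y \<le> Max (insert m S)" if "y \<in> {s \<in> P. f s \<le> 0}" for y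
          proof (cases "y \<le> m")
            case True
            then show ?thesis by (simp add: S_def Max_ge_iff)
          next
            case False
            with that show ?thesis by (intro Max_ge) (auto simp: S_def)
          qed
          have "Max (insert m S) \<in> insert m S"
            by (intro Max_in) (auto simp: S_def)
          then show "Max (insert m S) \<in> {s \<in> P. f s \<le> 0}"
            using m True by (auto simp: S_def)
        qed simp
        also have "\<dots> = (if S = {} then m else Max S)"
        proof (cases "S = {}")
          case False
          then have "m \<le> Max S"
            using Max_in[of S] by (auto simp: S_def)
          moreover have "finite S" by (simp add: S_def)
          ultimately show ?thesis using False by (simp add: max_def)
        qed simp
        finally show ?thesis .
      qed
      moreover have "{s \<in> P. f s \<le> 0} \<noteq> {}" using m True by auto
      ultimately show ?thesis
        using True unfolding rec P_def[symmetric]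
        by (simp add: IH Let_def del: Collect_empty_eq)
    next
      case False
      have "f s = partial_dual_deriv \<mu> lts (A + moment gts + moment eqs) (B + weight gts + weight eqs) s"
        if "s \<in> fst ` set lts" for s
        using less.prems[of s] that parts moment_weight_right_of_split[of s m cs]
        by (simp add: partial_dual_deriv_def P_def gts_def eqs_def lts_def algebra_simps)
      note slope = this
      define S where "S = {s \<in> P. s < m \<and> f s > 0}"
      have IH: "result (search_tm \<mu> lts (A + moment gts + moment eqs) (B + weight gts + weight eqs) lo m) =
          (if {s \<in> P. s < m \<and> f s \<le> 0} = {} then lo else Max {s \<in> P. s < m \<and> f s \<le> 0},
           if S = {} then m else Min S)"
        using less.IH[OF shorter(2), of "A + moment gts + moment eqs" "B + weight gts + weight eqs" lo m] slope
        unfolding parts Let_def S_def by (simp add: conj_assoc del: Collect_empty_eq)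
      \<comment> \<open>Every candidate for \<open>a\<close> survives, and \<open>m\<close> is below every dropped candidate for \<open>b\<close>.\<close>
      have "{s \<in> P. f s \<le> 0} = {s \<in> P. s < m \<and> f s \<le> 0}"
        using False monoD[OF assms(1)] by (fastforce simp: not_less[symmetric])
      moreover have "Min {s \<in> P. f s > 0} = (if S = {} then m else Min S)"
      proof -
        have "Min {s \<in> P. f s > 0} = Min (insert m S)"
        proof (rule Min_eqI)
          show "y \<ge> Min (insert m S)" if "y \<in> {s \<in> P. f s > 0}" for y
          proof (cases "y \<ge> m")
            case True
            then show ?thesis by (simp add: S_def Min_le_iff)
          next
            case False
            with that show ?thesis by (intro Min_le) (auto simp: S_def)
          qed
          have "Min (insert m S) \<in> insert m S"
            by (intro Min_in) (auto simp: S_def)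
          then show "Min (insert m S) \<in> {s \<in> P. f s > 0}"
            using m False by (auto simp: S_def)
        qed simp
        also have "\<dots> = (if S = {} then m else Min S)"
        proof (cases "S = {}")
          case False
          then have "m \<ge> Min S"
            using Min_in[of S] by (auto simp: S_def)
          moreover have "finite S" by (simp add: S_def)
          ultimately show ?thesis using False by (simp add: min_absorb2)
        qed simp
        finally show ?thesis .
      qed
      moreover have "{s \<in> P. f s > 0} \<noteq> {}" using m False by auto
      ultimately show ?thesis
        using False unfolding rec P_def[symmetric]
        by (simp add: IH Let_def del: Collect_empty_eq)
    qed
  qed
qed

lemma partial_dual_deriv_0: "partial_dual_deriv \<mu> cs 0 0 x = dual_deriv_ramps cs \<mu> x"
proof -
  have "moment (filter (\<lambda>c. fst c > x) cs) - weight (filter (\<lambda>c. fst c > x) cs) * x =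
      (\<Sum>c\<leftarrow>cs. snd c * max 0 (fst c - x))"
    unfolding moment_def weight_def by (induction cs) (auto simp: algebra_simps)
  then show ?thesis by (simp add: partial_dual_deriv_def dual_deriv_ramps_def)
qed

text \<open>
  Breakpoints may coincide, so the two sides need not have nearly equal length, but repeated
  medians are dropped whichever side survives.
\<close>

lemma length_filter_median_breakpoint_le:
  assumes "cs \<noteq> []"
  shows "2 * length (filter (\<lambda>c. fst c < median_breakpoint cs) cs) \<le> length cs"
    and "2 * length (filter (\<lambda>c. fst c > median_breakpoint cs) cs) \<le> length cs"
proof -
  define m where "m = median_breakpoint cs"
  have "has_rank (length cs div 2) (map fst cs) m"
    unfolding m_def median_breakpoint_def using assms by (intro has_rank_select_tm) simp
  moreover have "length (filter (\<lambda>c. fst c > m) cs) + length (filter (\<lambda>c. fst c \<le> m) cs) = length cs"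
    by (induction cs) auto
  ultimately show "2 * length (filter (\<lambda>c. fst c < median_breakpoint cs) cs) \<le> length cs"
    "2 * length (filter (\<lambda>c. fst c > median_breakpoint cs) cs) \<le> length cs"
    unfolding m_def[symmetric] has_rank_def filter_map o_def length_map by linarith+
qed

text \<open>
  Apart from the recursive call, a round costs at most \<open>2521 n + 1421\<close>, which \<open>n \<ge> 1\<close> turns into
  less than \<open>3950 n\<close>. Since the surviving list is at most half as long, twice this slope bounds the
  whole search.
\<close>

lemma cost_search_tm_le: "cost (search_tm \<mu> cs A B lo hi) \<le> 7900 * length cs + 5"
proof (induction cs arbitrary: A B lo hi rule: measure_induct_rule[of length])
  case (less cs)
  define n where "n = length cs"
  show ?case
  proof (cases "cs = []")
    case True
    then show ?thesis by (subst search_tm.simps) simp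
  next
    case False
    then have n: "n \<ge> 1" by (cases cs) (auto simp: n_def)
    define m where "m = median_breakpoint cs"
    define gts where "gts = filter (\<lambda>c. fst c > m) cs"
    define eqs where "eqs = filter (\<lambda>c. fst c = m) cs"
    define lts where "lts = filter (\<lambda>c. fst c < m) cs"
    have half: "2 * length gts \<le> n" "2 * length lts \<le> n"
      unfolding gts_def lts_def m_def n_def by (intro length_filter_median_breakpoint_le False)+
    have "length eqs \<le> n" unfolding eqs_def n_def by simp
    have right: "cost (search_tm \<mu> gts A B m hi) \<le> 7900 * length gts + 5" for A B
      by (rule less.IH) (use half n in \<open>simp add: n_def\<close>)
    have left: "cost (search_tm \<mu> lts A B lo m) \<le> 7900 * length lts + 5" for A B
      by (rule less.IH) (use half n in \<open>simp add: n_def\<close>)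
    define sel where "sel = select_tm (n div 2) (map fst cs)"
    have sel_le: "cost sel \<le> 2500 * n + 1400"
      using cost_select_tm_le[of "n div 2" "map fst cs"] by (simp add: sel_def n_def)
    have map: "cost (map_list_tm (\<lambda>(s, \<sigma>). return s) cs) \<le> 2 * n + 1"
      using cost_map_list_tm_le[of "\<lambda>(s, \<sigma>). return s" 0 cs] by (simp add: n_def case_prod_beta)
    have filters: "cost (filter_tm (\<lambda>(s, \<sigma>). op1 (Q s \<sigma>)) cs) \<le> 3 * n + 1" for Q
      using cost_filter_tm_le[of "\<lambda>(s, \<sigma>). op1 (Q s \<sigma>)" 1 cs] by (simp add: n_def case_prod_beta)
    have moments: "cost (sum_tm (\<lambda>(s, \<sigma>). op1 (\<sigma> * s)) ds) \<le> 3 * length ds + 1" for ds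
      using cost_sum_tm_le[of "\<lambda>(s, \<sigma>). op1 (\<sigma> * s)" 1 ds] by (simp add: case_prod_beta)
    have weights: "cost (sum_tm (\<lambda>(s, \<sigma>). return \<sigma>) ds) \<le> 2 * length ds + 1" for ds :: "(real \<times> real) list"
      using cost_sum_tm_le[of "\<lambda>(s, \<sigma>). return \<sigma>" 0 ds] by (simp add: case_prod_beta)
    have m: "result sel = m"
      by (simp add: m_def median_breakpoint_def n_def sel_def)
    have slope: "partial_dual_deriv \<mu> cs A B m = 1 - (A + moment gts - (B + weight gts) * m) / \<mu>"
      by (simp add: partial_dual_deriv_def gts_def)
    define common where "common = 2 * n + 11 + cost (map_list_tm (\<lambda>(s, \<sigma>). return s) cs) + cost sel
        + cost (filter_tm (\<lambda>(s, \<sigma>). op1 (s > m)) cs)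
        + cost (sum_tm (\<lambda>(s, \<sigma>). op1 (\<sigma> * s)) gts) + cost (sum_tm (\<lambda>(s, \<sigma>). return \<sigma>) gts)"
    define go_left where "go_left = cost (filter_tm (\<lambda>(s, \<sigma>). op1 (s = m)) cs)
            + cost (sum_tm (\<lambda>(s, \<sigma>). op1 (\<sigma> * s)) eqs) + cost (sum_tm (\<lambda>(s, \<sigma>). return \<sigma>) eqs)
            + 2 + cost (filter_tm (\<lambda>(s, \<sigma>). op1 (s < m)) cs)
            + cost (search_tm \<mu> lts (A + moment gts + moment eqs) (B + weight gts + weight eqs) lo m)"
    have "cost (search_tm \<mu> cs A B lo hi) =
        common + (if partial_dual_deriv \<mu> cs A B m \<le> 0 then cost (search_tm \<mu> gts A B m hi) else go_left)"
      using n unfolding common_def go_left_def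
      by (subst search_tm.simps)
        (simp add: cost_length_tm case_prod_beta n_def[symmetric] sel_def[symmetric] m gts_def[symmetric]
          eqs_def[symmetric] lts_def[symmetric] result_sum_tm moment_def[symmetric]
          weight_def[symmetric] slope)
    also have "\<dots> \<le> common + (3961 * n + 11)"
    proof -
      have "cost (search_tm \<mu> gts A B m hi) \<le> 3961 * n + 11"
        using right[of A B] half(1) by linarith
      moreover have "go_left \<le> 3961 * n + 11"
        unfolding go_left_def
        using left[of "A + moment gts + moment eqs" "B + weight gts + weight eqs"] half(2)
          filters[of "\<lambda>s \<sigma>. s = m"] filters[of "\<lambda>s \<sigma>. s < m"] moments[of eqs] weights[of eqs]
          \<open>length eqs \<le> n\<close>
        by linarith
      ultimately show ?thesis by simp
    qed
    also have "common \<le> 2510 * n + 1415"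
      unfolding common_def
      using sel_le map filters[of "\<lambda>s \<sigma>. s > m"] moments[of gts] weights[of gts] half(1)
      by linarith
    also have "2510 * n + 1415 + (3961 * n + 11) \<le> 7900 * n + 5"
      using n by linarith
    finally show ?thesis
      by (simp add: n_def)
  qed
qed


section \<open>The subroutine as a program\<close>

lemma result_dual_deriv_tm:
  assumes "\<mu> > 0" "\<kappa> \<ge> 0"
  shows "result (dual_deriv_tm u \<mu> \<kappa> x) = dual_deriv u \<mu> \<kappa> x"
proof -
  have "result (dual_deriv_tm u \<mu> \<kappa> x) = 1 - (\<Sum>y\<leftarrow>u. box_response \<mu> \<kappa> x y)"
    by (simp add: dual_deriv_tm_def result_sum_tm box_response_if[OF assms] if_distrib[of result] cong: if_cong)
  then show ?thesis by (simp add: dual_deriv_conv_box_response[OF assms])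
qed

lemma cost_dual_deriv_tm_le: "cost (dual_deriv_tm u \<mu> \<kappa> x) \<le> 8 * length u + 2"
  unfolding dual_deriv_tm_def cost_simps
  by (rule order.trans[OF add_right_mono[OF cost_sum_tm_le[where c = 6]]]) auto

lemma result_fast_subroutine_tm:
  assumes n: "length ls = n" "n \<ge> 1" and p: "0 \<le> p" "p < 1" and \<mu>: "0 < \<mu>"
  shows "result (fast_subroutine_tm ls \<mu> p) = fast_subroutine ls \<mu> p"
proof -
  define \<kappa> where "\<kappa> = cap n p"
  define u where "u = map (\<lambda>x. x + \<mu> / real n) ls"
  define cs where "cs = breakpoints u \<mu> \<kappa>"
  define P where "P = fst ` set cs"
  define f where "f = dual_deriv u \<mu> \<kappa>"
  define a where "a = Max {s \<in> P. f s \<le> 0}"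
  define b where "b = Min {s \<in> P. f s > 0}"
  define lam where "lam = a - f a * (b - a) / (f b - f a)"
  have \<kappa>: "\<kappa> \<ge> 0"
    using p by (simp add: \<kappa>_def cap_def)
  have ne: "{s \<in> P. f s \<le> 0} \<noteq> {}" "{s \<in> P. f s > 0} \<noteq> {}"
    using fast_subroutine_box_response[OF assms] unfolding P_def cs_def f_def u_def \<kappa>_def by blast+
  have count: "(\<Sum>x\<leftarrow>ls. 1) = real n"
    unfolding n(1)[symmetric] by (induction ls) auto
  have bps: "map (\<lambda>x. (x, 1)) u @ map (\<lambda>x. (x - \<mu> * \<kappa>, - 1)) u = cs"
    by (simp add: cs_def breakpoints_def)
  have "mono f"
    unfolding f_def by (intro monoI mono_dual_deriv \<mu> \<kappa>)
  moreover have "f s = partial_dual_deriv \<mu> cs 0 0 s" for s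
    by (simp add: f_def cs_def dual_deriv_conv_breakpoints[OF \<mu> \<kappa>] partial_dual_deriv_0)
  ultimately have search: "result (search_tm \<mu> cs 0 0 0 0) = (a, b)"
    using ne by (subst result_search_tm[of f])
      (simp_all add: Let_def a_def b_def P_def del: Collect_empty_eq)
  have P: "set u \<union> (\<lambda>x. x - \<mu> * \<kappa>) ` set u = P"
    by (auto simp: P_def cs_def breakpoints_def image_Un image_image)
  have "fast_subroutine ls \<mu> p = map (\<lambda>x. if lam < x - \<mu> * \<kappa> then \<kappa>
                 else if x - \<mu> * \<kappa> \<le> lam \<and> lam < x then (x - lam) / \<mu> else 0) u"
    unfolding fast_subroutine_def Let_def n(1) u_def[symmetric] \<kappa>_def[symmetric] P
      f_def[symmetric] a_def[symmetric] b_def[symmetric] lam_def[symmetric] by simp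
  moreover have "result (fast_subroutine_tm ls \<mu> p) = map (\<lambda>x. if lam < x - \<mu> * \<kappa> then \<kappa>
                 else if lam < x then (x - lam) / \<mu> else 0) u"
    unfolding fast_subroutine_tm_def result_simps result_map_list_tm result_sum_tm count
      result_append_tm u_def[symmetric] cap_def[symmetric] \<kappa>_def[symmetric] bps search prod.case
      result_dual_deriv_tm[OF \<mu> \<kappa>] f_def[symmetric] lam_def[symmetric]
    by (simp add: if_distrib[of result] cong: if_cong)
  ultimately show ?thesis by simp
qed

lemma cost_fast_subroutine_tm_le: "cost (fast_subroutine_tm ls \<mu> p) \<le> 15900 * length ls + 50"
proof -
  define n where "n = length ls"
  have map1: "cost (map_list_tm (\<lambda>x. op1 (g x)) xs) \<le> 3 * length xs + 1"
    for g :: "real \<Rightarrow> 'b" and xs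
    using cost_map_list_tm_le[of "\<lambda>x. op1 (g x)" 1 xs] by simp
  have map2: "cost (map_list_tm (\<lambda>x. do { v \<leftarrow> op1 (g x); op1 (h v) }) xs) \<le> 4 * length xs + 1"
    for g :: "real \<Rightarrow> real" and h :: "real \<Rightarrow> real \<times> real" and xs
    using cost_map_list_tm_le[of "\<lambda>x. do { v \<leftarrow> op1 (g x); op1 (h v) }" 2 xs] by simp
  have map3: "cost (map_list_tm (\<lambda>x. do {
            v \<leftarrow> op1 (x - w);
            c1 \<leftarrow> op1 (lam < v);
            if c1 then return \<kappa>
            else do {
              c2 \<leftarrow> op1 (lam < x);
              if c2 then do { z \<leftarrow> op1 (x - lam); op1 (z / \<mu>) } else return 0 } }) xs)
      \<le> 7 * length xs + 1" for w lam \<kappa> xs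
    by (rule order.trans[OF cost_map_list_tm_le[where c = 5]]) auto
  have count: "cost (sum_tm (\<lambda>_. return 1) ls) \<le> 2 * n + 1"
    using cost_sum_tm_le[of "\<lambda>_. return 1" 0 ls] by (simp add: n_def)
  define N where "N = (\<Sum>x\<leftarrow>ls. 1 :: real)"
  define \<kappa> where "\<kappa> = 1 / (N * (1 - p))"
  define u where "u = map (\<lambda>x. x + \<mu> / N) ls"
  define cs where "cs = map (\<lambda>x. (x, 1 :: real)) u @ map (\<lambda>x. (x - \<mu> * \<kappa>, - 1)) u"
  define ab where "ab = result (search_tm \<mu> cs 0 0 0 0)"
  define \<theta> where "\<theta> x = result (dual_deriv_tm u \<mu> \<kappa> x)" for x
  define lam where "lam = fst ab - \<theta> (fst ab) * (snd ab - fst ab) / (\<theta> (snd ab) - \<theta> (fst ab))"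
  have len: "length u = n" "length cs = 2 * n"
    by (simp_all add: u_def cs_def n_def)
  have "cost (fast_subroutine_tm ls \<mu> p) =
      cost (sum_tm (\<lambda>_. return 1) ls) + cost (map_list_tm (\<lambda>x. op1 (x + \<mu> / N)) ls)
      + cost (map_list_tm (\<lambda>x. op1 (x, 1 :: real)) u)
      + cost (map_list_tm (\<lambda>x. do { v \<leftarrow> op1 (x - \<mu> * \<kappa>); op1 (v, - 1 :: real) }) u)
      + (2 * n + 1) + cost (search_tm \<mu> cs 0 0 0 0)
      + cost (dual_deriv_tm u \<mu> \<kappa> (fst ab)) + cost (dual_deriv_tm u \<mu> \<kappa> (snd ab))
      + cost (map_list_tm (\<lambda>x. do {
            v \<leftarrow> op1 (x - \<mu> * \<kappa>);
            c1 \<leftarrow> op1 (lam < v);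
            if c1 then return \<kappa>
            else do {
              c2 \<leftarrow> op1 (lam < x);
              if c2 then do { z \<leftarrow> op1 (x - lam); op1 (z / \<mu>) } else return 0 } }) u) + 10"
    unfolding fast_subroutine_tm_def cost_simps result_simps result_map_list_tm result_sum_tm
      case_prod_beta cost_append_tm result_append_tm length_map N_def[symmetric] \<kappa>_def[symmetric]
      u_def[symmetric] cs_def[symmetric] ab_def[symmetric] \<theta>_def[symmetric] lam_def[symmetric] len
    by simp
  then show ?thesis
    using count map1[of "\<lambda>x. x + \<mu> / N" ls] map1[of "\<lambda>x. (x, 1 :: real)" u]
      map2[of "\<lambda>x. x - \<mu> * \<kappa>" "\<lambda>v. (v, - 1)" u] map3[of "\<mu> * \<kappa>" lam \<kappa> u]
      cost_search_tm_le[of \<mu> cs 0 0 0 0] cost_dual_deriv_tm_le[of u \<mu> \<kappa> "fst ab"]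
      cost_dual_deriv_tm_le[of u \<mu> \<kappa> "snd ab"]
    unfolding len n_def[symmetric] by linarith
qed


section \<open>Correctness and linear cost\<close>

theorem proposition3:
  shows "\<exists>T :: nat \<Rightarrow> real. T \<in> O(\<lambda>n. real n) \<and>
    (\<forall>n \<ge> 1. \<forall>p \<mu> (w :: real ^ 'd) (L :: nat \<Rightarrow> real ^ 'd \<Rightarrow> real).
      0 \<le> p \<longrightarrow> p < 1 \<longrightarrow> 0 < \<mu> \<longrightarrow>
      (let ls = map (\<lambda>i. L i w) [0..<n];
           q\<^sub>\<mu> = fast_subroutine ls \<mu> p
       in (\<forall>q. is_arg_max (objective ls \<mu>) (\<lambda>q. q \<in> feasible n p) q \<longleftrightarrow> q = q\<^sub>\<mu>)
          \<and> result (fast_subroutine_tm ls \<mu> p) = q\<^sub>\<mu>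
          \<and> real (cost (fast_subroutine_tm ls \<mu> p)) \<le> T n))"
proof (intro exI[of _ "\<lambda>n. 15900 * real n + 50"] conjI)
  show "(\<lambda>n. 15900 * real n + 50) \<in> O(\<lambda>n. real n)"
    by (intro bigoI[of _ 15950] eventually_sequentiallyI[of 1]) simp
  show "\<forall>n \<ge> 1. \<forall>p \<mu> (w :: real ^ 'd) (L :: nat \<Rightarrow> real ^ 'd \<Rightarrow> real).
      0 \<le> p \<longrightarrow> p < 1 \<longrightarrow> 0 < \<mu> \<longrightarrow>
      (let ls = map (\<lambda>i. L i w) [0..<n];
           q\<^sub>\<mu> = fast_subroutine ls \<mu> p
       in (\<forall>q. is_arg_max (objective ls \<mu>) (\<lambda>q. q \<in> feasible n p) q \<longleftrightarrow> q = q\<^sub>\<mu>)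
          \<and> result (fast_subroutine_tm ls \<mu> p) = q\<^sub>\<mu>
          \<and> real (cost (fast_subroutine_tm ls \<mu> p)) \<le> 15900 * real n + 50)"
  proof (intro allI impI, unfold Let_def, intro conjI allI)
    fix n :: nat and p \<mu> :: real and w :: "real ^ 'd" and L :: "nat \<Rightarrow> real ^ 'd \<Rightarrow> real"
    assume n: "1 \<le> n" and p: "0 \<le> p" "p < 1" and \<mu>: "0 < \<mu>"
    let ?ls = "map (\<lambda>i. L i w) [0..<n]"
    have len: "length ?ls = n" by simp
    show "is_arg_max (objective ?ls \<mu>) (\<lambda>q. q \<in> feasible n p) q \<longleftrightarrow> q = fast_subroutine ?ls \<mu> p" for q
      by (rule fast_subroutine_optimal[OF len n p \<mu>])
    show "result (fast_subroutine_tm ?ls \<mu> p) = fast_subroutine ?ls \<mu> p"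
      by (rule result_fast_subroutine_tm[OF len n p \<mu>])
    have "real (cost (fast_subroutine_tm ?ls \<mu> p)) \<le> real (15900 * length ?ls + 50)"
      using cost_fast_subroutine_tm_le by (rule of_nat_mono)
    then show "real (cost (fast_subroutine_tm ?ls \<mu> p)) \<le> 15900 * real n + 50"
      by simp
  qed
qed

end
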